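(* Let $G=(V,E)$ be any finite simple graph with $V=\{v_1,\dots,v_n\}$ and let $J=\{(i,j') : v_i\sim v_j \text{ in } G\}$ (a symmetric subgraph of $K_{n,n}$). Then $\chi(G^k)=\chi(G)$ for all $k\ge 1$.
   Context: Let $K_{n,n}$ be the complete bipartite graph with parts $I_n=\{1,\dots,n\}$ and $I_n'=\{1',\dots,n'\}$; a subgraph $J$ of $K_{n,n}$ with vertex set $I_n\cup I_n'$ is symmetric if $i\sim j'$ iff $j\sim i'$. The self-similar graphs based on $(G,J)$: $G^1=G$; for $k\ge2$, $V(G^k)=V^k$, and $(v_{i_1},\dots,v_{i_k})\sim(v_{j_1},\dots,v_{j_k})$ in $G^k$ iff either (1) $(v_{i_1},\dots,v_{i_{k-1}})=(v_{j_1},\dots,v_{j_{k-1}})$ and $v_{i_k}\sim v_{j_k}$ in $G$, or (2) $(v_{i_1},\dots,v_{i_{k-1}})\sim(v_{j_1},\dots,v_{j_{k-1}})$ in $G^{k-1}$ and $i_k\sim j_k'$ in $J$. *)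

theory Defs
  imports "Graph_Theory.Graph_Theory"
begin

text \<open>
  A simple graph is a pair_graph of Graph_Theory: a finite loop-free digraph whose set of arcs
  is a symmetric set of pairs, so that the vertices u and v are adjacent iff
  (u, v) is in parcs G.
\<close>

definition proper_coloring :: "'a pair_pre_digraph \<Rightarrow> nat \<Rightarrow> ('a \<Rightarrow> nat) \<Rightarrow> bool" where
  "proper_coloring G m c \<longleftrightarrow>
     (\<forall>u \<in> pverts G. c u < m) \<and> (\<forall>(u, w) \<in> parcs G. c u \<noteq> c w)"

definition chromatic_number :: "'a pair_pre_digraph \<Rightarrow> nat" where
  "chromatic_number G = (LEAST m. \<exists>c. proper_coloring G m c)"

lemma (in pair_graph) chromatic_number_attained:
  "\<exists>c. proper_coloring G (chromatic_number G) c"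
proof -
  obtain c where c: "bij_betw c (pverts G) {0..<card (pverts G)}"
    using ex_bij_betw_finite_nat[OF pair_finite_verts] by blast
  have "proper_coloring G (card (pverts G)) c"
    unfolding proper_coloring_def
  proof (intro conjI ballI)
    fix u assume "u \<in> pverts G"
    then show "c u < card (pverts G)" using c by (auto simp: bij_betw_def)
  next
    fix e assume e: "e \<in> parcs G"
    then have "fst e \<noteq> snd e" "fst e \<in> pverts G" "snd e \<in> pverts G"
      by (auto simp: pair_no_loops arc_fst_in_verts arc_snd_in_verts)
    then show "case e of (u, w) \<Rightarrow> c u \<noteq> c w"
      using c by (cases e) (auto simp: bij_betw_def dest: inj_onD)
  qed
  then have "\<exists>c. proper_coloring G (card (pverts G)) c" by blast
  then show ?thesis
    unfolding chromatic_number_def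
    by (rule LeastI[of "\<lambda>m. \<exists>c. proper_coloring G m c"])
qed

text \<open>
  In K_{n,n} the vertex i is represented by Inl i and the vertex i' by Inr i.
\<close>

definition K_parts :: "nat \<Rightarrow> (nat + nat) pair_pre_digraph" where
  "K_parts n = \<lparr> pverts = Inl ` {1..n} \<union> Inr ` {1..n},
     parcs = Inl ` {1..n} \<times> Inr ` {1..n} \<union> Inr ` {1..n} \<times> Inl ` {1..n} \<rparr>"

lemma K_parts_complete_bipartite: "complete_bipartite_digraph n n (with_proj (K_parts n))"
  unfolding complete_bipartite_digraph_pair_def
proof (intro conjI exI)
  show "pverts (K_parts n) = Inl ` {1..n} \<union> Inr ` {1..n}"
    and "parcs (K_parts n) = Inl ` {1..n} \<times> Inr ` {1..n} \<union> Inr ` {1..n} \<times> Inl ` {1..n}"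
    by (simp_all add: K_parts_def)
qed (auto simp: K_parts_def card_image)

definition symmetric_bip :: "nat \<Rightarrow> (nat + nat) pair_pre_digraph \<Rightarrow> bool" where
  "symmetric_bip n J \<longleftrightarrow>
     pair_graph J \<and> spanning (with_proj J) (with_proj (K_parts n)) \<and>
     (\<forall>i \<in> {1..n}. \<forall>j \<in> {1..n}. (Inl i, Inr j) \<in> parcs J \<longleftrightarrow> (Inl j, Inr i) \<in> parcs J)"

definition adjacency_bip ::
  "'a pair_pre_digraph \<Rightarrow> nat \<Rightarrow> (nat \<Rightarrow> 'a) \<Rightarrow> (nat + nat) pair_pre_digraph" where
  "adjacency_bip G n v = \<lparr> pverts = Inl ` {1..n} \<union> Inr ` {1..n},
     parcs = {(Inl i, Inr j) | i j. i \<in> {1..n} \<and> j \<in> {1..n} \<and> (v i, v j) \<in> parcs G}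
           \<union> {(Inr j, Inl i) | i j. i \<in> {1..n} \<and> j \<in> {1..n} \<and> (v i, v j) \<in> parcs G} \<rparr>"

lemma adjacency_bip_symmetric_bip:
  assumes "pair_graph G"
  shows "symmetric_bip n (adjacency_bip G n v)"
proof -
  interpret G: pair_graph G by fact
  have sym: "(x, y) \<in> parcs G \<Longrightarrow> (y, x) \<in> parcs G" for x y
    using G.pair_sym_arcs by (auto simp: symmetric_def sym_def)
  let ?J = "adjacency_bip G n v"
  have sub: "parcs ?J \<subseteq> pverts ?J \<times> pverts ?J"
    by (auto simp: adjacency_bip_def)
  have fin: "finite (pverts ?J)" by (simp add: adjacency_bip_def)
  have J: "pair_graph ?J"
  proof unfold_locales
    show "finite (parcs ?J)" using sub fin by (meson finite_SigmaI finite_subset)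
    show "symmetric (with_proj ?J)"
      by (auto simp: adjacency_bip_def symmetric_def sym_def)
  qed (use sub fin in \<open>auto simp: adjacency_bip_def\<close>)
  then interpret J: pair_graph ?J .
  interpret K: pair_graph "K_parts n"
    by (rule pair_graphI_complete_bipartite[OF K_parts_complete_bipartite])
  have "spanning (with_proj ?J) (with_proj (K_parts n))"
    unfolding spanning_def subgraph_def compatible_def
    using J.wf_digraph K.wf_digraph
    by (auto simp: adjacency_bip_def K_parts_def)
  then show ?thesis
    unfolding symmetric_bip_def using J sym by (auto simp: adjacency_bip_def)
qed

text \<open>
  The vertex (v_{i_1}, ..., v_{i_k}) of G^k is represented by the list of its entries, so that
  xs is the tuple of the first k - 1 entries of xs @ [x]. In particular the vertices of G^1 are
  the one-element lists over V. Only k at least 1 is meaningful; the value at 0 is a dummy.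
\<close>

fun self_similar_graph ::
  "'a pair_pre_digraph \<Rightarrow> nat \<Rightarrow> (nat \<Rightarrow> 'a) \<Rightarrow> (nat + nat) pair_pre_digraph \<Rightarrow> nat
    \<Rightarrow> 'a list pair_pre_digraph" where
  "self_similar_graph G n v J 0 = \<lparr> pverts = {}, parcs = {} \<rparr>"
| "self_similar_graph G n v J (Suc 0) =
     \<lparr> pverts = {[x] | x. x \<in> pverts G}, parcs = {([x], [y]) | x y. (x, y) \<in> parcs G} \<rparr>"
| "self_similar_graph G n v J (Suc (Suc k)) =
     \<lparr> pverts = {xs. length xs = Suc (Suc k) \<and> set xs \<subseteq> pverts G},
       parcs =
         {(xs @ [x], xs @ [y]) | xs x y.
            length xs = Suc k \<and> set xs \<subseteq> pverts G \<and> (x, y) \<in> parcs G}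
       \<union> {(xs @ [v i], ys @ [v j]) | xs ys i j.
            (xs, ys) \<in> parcs (self_similar_graph G n v J (Suc k)) \<and>
            i \<in> {1..n} \<and> j \<in> {1..n} \<and> (Inl i, Inr j) \<in> parcs J} \<rparr>"

lemma self_similar_graph_verts:
  "k \<ge> 1 \<Longrightarrow>
    pverts (self_similar_graph G n v J k) = {xs. length xs = k \<and> set xs \<subseteq> pverts G}"
proof (induction G n v J k rule: self_similar_graph.induct)
  case (2 G n v J)
  show ?case by (auto simp: length_Suc_conv)
qed simp_all

lemma self_similar_graph_pair_graph:
  assumes "pair_graph G" and "bij_betw v {1..n} (pverts G)" and J: "symmetric_bip n J"
  shows "pair_graph (self_similar_graph G n v J k)"
proof -
  interpret G: pair_graph G by fact
  have symG: "(x, y) \<in> parcs G \<Longrightarrow> (y, x) \<in> parcs G" for x y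
    using G.pair_sym_arcs by (auto simp: symmetric_def sym_def)
  have irr: "(x, x) \<notin> parcs G" for x
    using G.pair_no_loops by fastforce
  have symJ: "(Inl j, Inr i) \<in> parcs J"
    if "(Inl i, Inr j) \<in> parcs J" "i \<in> {1..n}" "j \<in> {1..n}" for i j
    using J that by (auto simp: symmetric_bip_def)
  have v: "v i \<in> pverts G" if "i \<in> {1..n}" for i
    using assms(2) that by (auto simp: bij_betw_def)
  let ?G = "self_similar_graph G n v J"
  have step: "parcs (?G (Suc m)) \<subseteq> pverts (?G (Suc m)) \<times> pverts (?G (Suc m))
      \<and> sym (parcs (?G (Suc m))) \<and> irrefl (parcs (?G (Suc m)))" for m
  proof (induction m)
    case 0
    then show ?case
      by (auto simp: sym_def irrefl_def irr intro: symG dest: G.in_arcsD1 G.in_arcsD2)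
  next
    case (Suc m)
    have in_verts: "length xs = Suc m \<and> set xs \<subseteq> pverts G \<and> length ys = Suc m \<and> set ys \<subseteq> pverts G"
      and symm: "(ys, xs) \<in> parcs (?G (Suc m))" and ne: "xs \<noteq> ys"
      if "(xs, ys) \<in> parcs (?G (Suc m))" for xs ys
      using Suc that self_similar_graph_verts[of "Suc m" G n v J]
      by (auto simp: sym_def irrefl_def)
    have arc: "e \<in> pverts (?G (Suc (Suc m))) \<times> pverts (?G (Suc (Suc m)))
        \<and> (snd e, fst e) \<in> parcs (?G (Suc (Suc m))) \<and> fst e \<noteq> snd e"
      if "e \<in> parcs (?G (Suc (Suc m)))" for e
    proof -
      from that consider
        (same) xs x y where "e = (xs @ [x], xs @ [y])" "length xs = Suc m" "set xs \<subseteq> pverts G"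
          "(x, y) \<in> parcs G"
      | (step) xs ys i j where "e = (xs @ [v i], ys @ [v j])" "(xs, ys) \<in> parcs (?G (Suc m))"
          "i \<in> {1..n}" "j \<in> {1..n}" "(Inl i, Inr j) \<in> parcs J"
        by (simp del: atLeastAtMost_iff) blast
      then show ?thesis
      proof cases
        case same
        then show ?thesis
          using irr symG[OF same(4)] G.in_arcsD1[OF same(4)] G.in_arcsD2[OF same(4)] by auto
      next
        case step
        have "(snd e, fst e) \<in> parcs (?G (Suc (Suc m)))"
          using step symm[OF step(2)] symJ[OF step(5,3,4)]
          by (simp del: atLeastAtMost_iff) blast
        then show ?thesis
          using step in_verts[OF step(2)] ne[OF step(2)] v[OF step(3)] v[OF step(4)] by auto
      qed
    qed
    have "parcs (?G (Suc (Suc m))) \<subseteq> pverts (?G (Suc (Suc m))) \<times> pverts (?G (Suc (Suc m)))"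
      using arc by blast
    moreover have "sym (parcs (?G (Suc (Suc m))))"
      using arc by (metis fst_conv snd_conv symI)
    moreover have "irrefl (parcs (?G (Suc (Suc m))))"
      using arc by (metis fst_conv snd_conv irreflI)
    ultimately show ?case by blast
  qed
  show ?thesis
  proof (cases k)
    case 0
    then show ?thesis by unfold_locales (auto simp: symmetric_def sym_def)
  next
    case (Suc m)
    have fin: "finite (pverts (?G k))"
      using finite_lists_length_eq[OF G.pair_finite_verts, of k] Suc
      by (simp add: self_similar_graph_verts conj_commute)
    show ?thesis
    proof unfold_locales
      show "finite (parcs (?G k))"
        using step[of m] fin Suc by (meson finite_SigmaI finite_subset)
      show "symmetric (with_proj (?G k))"
        using step[of m] Suc by (simp add: symmetric_def)
    qed (use step[of m] fin Suc in \<open>auto simp: irrefl_def\<close>)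
  qed
qed

end

(* G and G^k are homomorphically equivalent: the last coordinate is a homomorphism from G^k to G,
   because J is the adjacency of G, and the diagonal is a homomorphism from G to G^k. *)
theory Submission
  imports Defs
begin

text \<open>Proper colorings pull back along homomorphisms, so homomorphisms both ways give equal
  chromatic numbers (\<open>chromatic_number_eq_if_homs\<close>). They are \<open>last\<close>
  (\<open>graph_hom_last\<close>) and the diagonal \<open>replicate k\<close>
  (\<open>graph_hom_replicate\<close>).\<close>

definition graph_hom ::
  "'a pair_pre_digraph \<Rightarrow> 'b pair_pre_digraph \<Rightarrow> ('a \<Rightarrow> 'b) \<Rightarrow> bool" where
  "graph_hom G H f \<longleftrightarrow>
     f ` pverts G \<subseteq> pverts H \<and> (\<forall>(x, y) \<in> parcs G. (f x, f y) \<in> parcs H)"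

lemma proper_coloring_comp_hom:
  assumes "graph_hom G H f" and "proper_coloring H m c"
  shows "proper_coloring G m (c \<circ> f)"
  using assms unfolding graph_hom_def proper_coloring_def by fastforce

text \<open>Both graphs have proper colorings for exactly the same \<open>m\<close>, so both
  \<open>LEAST\<close> terms agree.\<close>

lemma chromatic_number_eq_if_homs:
  assumes "graph_hom G H f" and "graph_hom H G g"
  shows "chromatic_number G = chromatic_number H"
  unfolding chromatic_number_def
  using proper_coloring_comp_hom[OF assms(1)] proper_coloring_comp_hom[OF assms(2)]
  by (metis (no_types, lifting))

text \<open>Needs no induction: an arc of either kind has last entries adjacent in \<open>G\<close>,
  directly for kind (1), through \<open>adjacency_bip\<close> for kind (2).\<close>

lemma graph_hom_last:
  assumes "k \<ge> 1"
  shows "graph_hom (self_similar_graph G n v (adjacency_bip G n v) k) G last"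
proof -
  let ?G = "self_similar_graph G n v (adjacency_bip G n v)"
  have "last ` pverts (?G k) \<subseteq> pverts G"
    using assms by (fastforce simp: self_similar_graph_verts intro: last_in_set)
  moreover have "(last xs, last ys) \<in> parcs G" if "(xs, ys) \<in> parcs (?G k)" for xs ys
    using that assms
    by (cases "(G, n, v, adjacency_bip G n v, k)" rule: self_similar_graph.cases)
      (auto simp: adjacency_bip_def)
  ultimately show ?thesis
    unfolding graph_hom_def by blast
qed

text \<open>Arcs of kind (2) suffice: each one extends a diagonal arc by the same arc of
  \<open>G\<close>.\<close>

lemma graph_hom_replicate:
  assumes "pair_graph G" and v: "bij_betw v {1..n} (pverts G)" and "k \<ge> 1"
  shows "graph_hom G (self_similar_graph G n v (adjacency_bip G n v) k) (replicate k)"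
proof -
  interpret pair_graph G by fact
  let ?G = "self_similar_graph G n v (adjacency_bip G n v)"
  have "(replicate (Suc m) x, replicate (Suc m) y) \<in> parcs (?G (Suc m))"
    if xy: "(x, y) \<in> parcs G" for m x y
  proof (induction m)
    case 0
    then show ?case using xy by simp
  next
    case (Suc m)
    \<comment> \<open>Arcs of \<open>adjacency_bip\<close> join indices; surjectivity of
      \<open>v\<close> supplies them.\<close>
    obtain i j where ij: "i \<in> {1..n}" "j \<in> {1..n}" "x = v i" "y = v j"
      using v in_arcsD1[OF xy] in_arcsD2[OF xy] unfolding bij_betw_def by blast
    then have "(Inl i, Inr j) \<in> parcs (adjacency_bip G n v)"
      using xy by (auto simp: adjacency_bip_def)
    then have "(replicate (Suc m) x @ [x], replicate (Suc m) y @ [y]) \<in> parcs (?G (Suc (Suc m)))"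
      using Suc ij by (simp del: replicate_Suc atLeastAtMost_iff) blast
    \<comment> \<open>Tuples grow at the end, while \<open>replicate_Suc\<close> adds in
      front.\<close>
    then show ?case
      by (metis replicate_append_same replicate_Suc)
  qed
  then have "(replicate k x, replicate k y) \<in> parcs (?G k)" if "(x, y) \<in> parcs G" for x y
    using that \<open>k \<ge> 1\<close> by (cases k) (simp_all del: replicate_Suc)
  moreover have "replicate k ` pverts G \<subseteq> pverts (?G k)"
    using \<open>k \<ge> 1\<close> by (auto simp: self_similar_graph_verts)
  ultimately show ?thesis
    unfolding graph_hom_def by blast
qed

theorem theorem3p2:
  fixes G :: "'a pair_pre_digraph" and v :: "nat \<Rightarrow> 'a" and n k :: nat
  assumes "pair_graph G"
    and "bij_betw v {1..n} (pverts G)"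
    and "k \<ge> 1"
  shows "chromatic_number (self_similar_graph G n v (adjacency_bip G n v) k) = chromatic_number G"
  using graph_hom_last[OF assms(3)] graph_hom_replicate[OF assms]
  by (rule chromatic_number_eq_if_homs)

end
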